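(* Let $(x_k)_{k\ge 0}$ be generated by the inexact proximal-gradient iteration $x_{k+1}=\operatorname{prox}_{1/L}\{x_k-\tfrac1L(\nabla f(x_k)+e_k)\}$ described in the context. For $k\ge1$ and $\epsilon>0$, $$\Pr(\pi_k-\rho^k\pi_0\ge\epsilon)\le\inf_{\theta>0}\left\{\frac{\exp(-\theta\vartheta\epsilon/R_k)}{R_k}\sum_{i=0}^{k-1}\rho^{k-1-i}\gamma_i(\theta)\right\}.$$ If moreover $\gamma_k\equiv\gamma$ for all $k$ (i.e. the $\|e_k\|^2$ are identically distributed), then $$\Pr(\pi_k-\rho^k\pi_0\ge\epsilon)\le\inf_{\theta>0}\left\{\exp(-\theta\vartheta\epsilon/R_k)\,\gamma(\theta)\right\}.$$
   Context: Setting. $f:\mathbb R^n\to\mathbb R$ is differentiable, $g:\mathbb R^n\to(-\infty,+\infty]$ is proper, convex and lower semicontinuous, $h:=f+g$, and the solution set $\mathcal S:=\arg\min h$ is nonempty. $\|\cdot\|$ is the Euclidean norm. For $\alpha>0$, $\operatorname{prox}_\alpha\{z\}:=\arg\min_y\{\alpha g(y)+\tfrac12\|z-y\|^2\}$. There are constants $L>0$ and $\tau\ge 1$ such that for all $x,y\in\mathbb R^n$: $\|\nabla f(y)-\nabla f(x)\|\le L\|y-x\|$, and $\min_{\bar x\in\mathcal S}\|x-\bar x\|\le\tau\,\|x-\operatorname{prox}_{1/L}\{x-\tfrac1L\nabla f(x)\}\|$. The iteration starts from a deterministic $x_0\in\operatorname{dom} g$, and $e_k$ ($k\ge 0$) are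 random vectors in $\mathbb R^n$ (no independence assumed). The optimality gap is $\pi_k:=h(x_k)-\inf h$. Constants: $\rho:=\frac{40\tau^2}{1+40\tau^2}$, $\vartheta:=L\,\frac{1+40\tau^2}{40\tau^2}$, $R_k:=\sum_{i=0}^{k-1}\rho^i$. The moment-generating function of the squared error norm is $\gamma_k(\theta):=\mathbf E\exp(\theta\|e_k\|^2)$, with value $+\infty$ where the expectation is not finite. *)

theory Defs
  imports "HOL-Probability.Probability"
begin

definition proper_fun :: "('a \<Rightarrow> ereal) \<Rightarrow> bool" where
  "proper_fun g \<longleftrightarrow> (\<forall>x. g x \<noteq> -\<infinity>) \<and> (\<exists>x. g x \<noteq> \<infinity>)"

(* Since 0 * \<infinity> = 0 in ereal, the endpoint cases u = 0 and v = 0 impose no condition. *)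
definition convex_fun :: "('a::real_vector \<Rightarrow> ereal) \<Rightarrow> bool" where
  "convex_fun g \<longleftrightarrow>
     (\<forall>x y. \<forall>u\<ge>0. \<forall>v\<ge>0. u + v = 1 \<longrightarrow>
        g (u *\<^sub>R x + v *\<^sub>R y) \<le> ereal u * g x + ereal v * g y)"

definition lsc_fun :: "('a::topological_space \<Rightarrow> ereal) \<Rightarrow> bool" where
  "lsc_fun g \<longleftrightarrow> (\<forall>x. g x \<le> Liminf (at x) g)"

definition eff_dom :: "('a \<Rightarrow> ereal) \<Rightarrow> 'a set" where
  "eff_dom g = {x. g x < \<infinity>}"

definition composite :: "('a \<Rightarrow> real) \<Rightarrow> ('a \<Rightarrow> ereal) \<Rightarrow> 'a \<Rightarrow> ereal" where
  "composite f g x = ereal (f x) + g x"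

definition argmin_set :: "('a \<Rightarrow> ereal) \<Rightarrow> 'a set" where
  "argmin_set h = {x. is_arg_min h (\<lambda>_. True) x}"

(* For proper, convex, lower semicontinuous g and \<alpha> > 0 the minimizer exists and is unique,
   so the choice made by ARG_MIN is immaterial. *)
definition prox :: "real \<Rightarrow> ('a::real_normed_vector \<Rightarrow> ereal) \<Rightarrow> 'a \<Rightarrow> 'a" where
  "prox \<alpha> g z = (ARG_MIN (\<lambda>y. ereal \<alpha> * g y + ereal (1/2 * (norm (z - y))\<^sup>2)) y. True)"

definition opt_gap :: "('a \<Rightarrow> ereal) \<Rightarrow> 'a \<Rightarrow> ereal" where
  "opt_gap h x = h x - (INF y. h y)"

definition rho :: "real \<Rightarrow> real" where
  "rho \<tau> = 40 * \<tau>\<^sup>2 / (1 + 40 * \<tau>\<^sup>2)"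

definition vartheta :: "real \<Rightarrow> real \<Rightarrow> real" where
  "vartheta L \<tau> = L * ((1 + 40 * \<tau>\<^sup>2) / (40 * \<tau>\<^sup>2))"

definition Rsum :: "real \<Rightarrow> nat \<Rightarrow> real" where
  "Rsum \<tau> k = (\<Sum>i<k. rho \<tau> ^ i)"

(* The moment-generating function of the squared norm of E; the nonnegative integral is
   \<infinity> exactly when the expectation is not finite. *)
definition sqnorm_mgf ::
    "'w measure \<Rightarrow> ('w \<Rightarrow> 'a::real_normed_vector) \<Rightarrow> real \<Rightarrow> ennreal" where
  "sqnorm_mgf M E \<theta> = (\<integral>\<^sup>+\<omega>. ennreal (exp (\<theta> * (norm (E \<omega>))\<^sup>2)) \<partial>M)"

end

theory Submission
  imports Defs
begin

text \<open>Let \<open>y\<close> be the inexact step from \<open>x\<close> with error \<open>e\<close>, and put \<open>r = \<parallel>x - y\<parallel>\<close>,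
  \<open>u = \<parallel>e\<parallel>/L\<close>. The subgradient inequality at the proximal point and the quadratic bounds on
  \<open>f\<close> around \<open>x\<close> give two estimates: the decrease
  \<open>\<pi>(x) - \<pi>(y) \<ge> L (r\<^sup>2/2 - u r)\<close> and, for every minimizer \<open>w\<close>,
  \<open>\<pi>(y) \<le> L \<parallel>x - w\<parallel>\<^sup>2 + L u\<^sup>2/2\<close>. The exact proximal step differs from \<open>y\<close> by at most
  \<open>u\<close>, so the error bound turns the second into \<open>\<pi>(y) \<le> L \<tau>\<^sup>2 (r + u)\<^sup>2 + L u\<^sup>2/2\<close>. Together
  they yield \<open>\<pi>(y) \<le> \<rho> \<pi>(x) + \<parallel>e\<parallel>\<^sup>2/\<vartheta>\<close>. Unrolling, \<open>\<vartheta> (\<pi>\<^sub>k - \<rho>\<^sup>k \<pi>\<^sub>0)\<close> is at most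
  \<open>R\<^sub>k\<close> times a convex combination of the \<open>\<parallel>e\<^sub>i\<parallel>\<^sup>2\<close>; Jensen's inequality for \<open>exp\<close> and Markov's
  inequality conclude without any independence.\<close>

section \<open>Lower semicontinuity and existence of proximal points\<close>

text \<open>A real \<open>a\<close> strictly between \<open>u x\<close> and \<open>g x\<close>
  decouples the two functions: near \<open>x\<close>, \<open>g\<close> stays above \<open>a\<close>
  and \<open>u\<close> stays below it. With \<open>u\<close> quadratic, this gives closed sublevel
  sets of the proximal objective.\<close>

lemma lsc_fun_open_greater:
  fixes g :: "'a::topological_space \<Rightarrow> ereal" and u :: "'a \<Rightarrow> real"
  assumes "lsc_fun g" "continuous_on UNIV u"
  shows "open {x. ereal (u x) < g x}"
proof (subst open_subopen, safe)
  fix x assume "ereal (u x) < g x"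
  then obtain a where a: "ereal (u x) < ereal a" "ereal a < g x"
    using ereal_dense2 by blast
  have "\<forall>y<g x. eventually (\<lambda>z. y < g z) (at x)"
    using assms(1) le_Liminf_iff[of "g x" "at x" g] by (simp add: lsc_fun_def)
  \<comment> \<open>The filter \<open>at x\<close> is punctured; the point \<open>x\<close> itself
    is covered by \<open>ereal a < g x\<close>.\<close>
  with a have "eventually (\<lambda>z. ereal a < g z) (nhds x)"
    by (simp add: eventually_nhds_conv_at)
  then obtain U where U: "open U" "x \<in> U" "\<forall>z\<in>U. ereal a < g z"
    by (auto simp: eventually_nhds)
  have "open (U \<inter> {z. u z < a})"
    using assms(2) by (intro open_Int U(1) open_Collect_less continuous_on_const)
  moreover have "U \<inter> {z. u z < a} \<subseteq> {z. ereal (u z) < g z}"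
    using U(3) by (auto intro: less_trans[of "ereal _" "ereal a"])
  ultimately show "\<exists>T. open T \<and> x \<in> T \<and> T \<subseteq> {z. ereal (u z) < g z}"
    using U(2) a(1) by (intro exI[of _ "U \<inter> {z. u z < a}"]) auto
qed

text \<open>The minimizers form the intersection of all sublevel sets. Finitely many of these always
  share a point, namely the base point with the least value, so compactness makes the whole
  intersection nonempty.\<close>

lemma closed_sublevels_attain_min:
  fixes \<phi> :: "'a::topological_space \<Rightarrow> 'b::linorder"
  assumes "\<And>a. closed {x. \<phi> x \<le> \<phi> a}" "compact {x. \<phi> x \<le> \<phi> s}"
  shows "\<exists>y. \<forall>z. \<phi> y \<le> \<phi> z"
proof -
  have "{x. \<phi> x \<le> \<phi> s} \<inter> (\<Inter>a\<in>UNIV. {x. \<phi> x \<le> \<phi> a}) \<noteq> {}"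
  proof (rule compact_imp_fip_image[OF assms(2) assms(1)])
    fix I' :: "'a set" assume "finite I'"
    then have "finite (\<phi> ` insert s I')" "\<phi> ` insert s I' \<noteq> {}" by auto
    from Min_in[OF this] obtain m where m: "\<phi> m = Min (\<phi> ` insert s I')"
      by (metis imageE)
    have "\<phi> m \<le> \<phi> a" if "a \<in> insert s I'" for a
      unfolding m using that \<open>finite (\<phi> ` insert s I')\<close> by (intro Min_le) auto
    then show "{x. \<phi> x \<le> \<phi> s} \<inter> (\<Inter>a\<in>I'. {x. \<phi> x \<le> \<phi> a}) \<noteq> {}"
      by blast
  qed
  then show ?thesis by blast
qed

text \<open>The quadratic outgrows the affine minorant, so the sublevel set at \<open>s\<close> is
  bounded and hence compact.\<close>

lemma prox_objective_attains_min:
  fixes g :: "'a::euclidean_space \<Rightarrow> ereal"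
  assumes lsc: "lsc_fun g" and finite_point: "g s \<noteq> \<infinity>" and \<alpha>: "\<alpha> > 0"
    and minorant: "\<And>y. ereal (c + v \<bullet> y) \<le> g y"
  shows "\<exists>y. \<forall>w. ereal \<alpha> * g y + ereal (1/2 * (norm (z - y))\<^sup>2)
                  \<le> ereal \<alpha> * g w + ereal (1/2 * (norm (z - w))\<^sup>2)"
proof -
  define \<phi> where "\<phi> y = ereal \<alpha> * g y + ereal (1/2 * (norm (z - y))\<^sup>2)" for y
  have not_minf: "g y \<noteq> - \<infinity>" for y using minorant[of y] by auto
  \<comment> \<open>Moving the quadratic to the right leaves \<open>g\<close> compared with a
    continuous real function, the form that \<open>lsc_fun_open_greater\<close> handles.\<close>
  have sublevel: "{y. \<phi> y \<le> ereal r} = {y. g y \<le> ereal ((r - 1/2 * (norm (z - y))\<^sup>2) / \<alpha>)}" for r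
  proof -
    have "\<phi> y \<le> ereal r \<longleftrightarrow> g y \<le> ereal ((r - 1/2 * (norm (z - y))\<^sup>2) / \<alpha>)" for y
      unfolding \<phi>_def using not_minf[of y] \<alpha> by (cases "g y") (auto simp: field_simps)
    then show ?thesis by simp
  qed
  have closed_r: "closed {y. \<phi> y \<le> ereal r}" for r
  proof -
    have "open {y. ereal ((r - 1/2 * (norm (z - y))\<^sup>2) / \<alpha>) < g y}"
      by (rule lsc_fun_open_greater[OF lsc]) (use \<alpha> in \<open>auto intro!: continuous_intros\<close>)
    then show ?thesis
      unfolding sublevel closed_def by (simp add: Collect_neg_eq[symmetric] not_le)
  qed
  have closed_sub: "closed {y. \<phi> y \<le> \<phi> a}" for a
  proof (cases "\<phi> a")
    case (real r)
    then show ?thesis using closed_r[of r] by simp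
  next
    case MInf
    then show ?thesis using not_minf[of a] \<alpha> by (cases "g a") (auto simp: \<phi>_def)
  qed simp
  obtain r where r: "\<phi> s = ereal r"
    unfolding \<phi>_def using finite_point not_minf[of s] by (cases "g s") auto
  \<comment> \<open>With t = \<open>norm (z - y)\<close>, membership in the sublevel set gives t^2/2
    - \<alpha> |v| t \<le> \<open>K\<close>; completing the square bounds (t - \<alpha> |v|)^2 by
    \<open>B\<close>.\<close>
  define K where "K = r - \<alpha> * c - \<alpha> * (v \<bullet> z)"
  define B where "B = 2 * K + (\<alpha> * norm v)\<^sup>2"
  have "{y. \<phi> y \<le> \<phi> s} \<subseteq> cball z (\<alpha> * norm v + 1 + B)"
  proof
    fix y assume "y \<in> {y. \<phi> y \<le> \<phi> s}"
    then have "g y \<le> ereal ((r - 1/2 * (norm (z - y))\<^sup>2) / \<alpha>)"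
      unfolding r sublevel by simp
    then have "ereal (c + v \<bullet> y) \<le> ereal ((r - 1/2 * (norm (z - y))\<^sup>2) / \<alpha>)"
      using minorant[of y] by (rule order_trans[rotated])
    then have 1: "\<alpha> * (c + v \<bullet> y) + 1/2 * (norm (z - y))\<^sup>2 \<le> r"
      using \<alpha> by (simp add: field_simps)
    have "v \<bullet> (z - y) \<le> norm v * norm (z - y)" by (rule norm_cauchy_schwarz)
    then have "\<alpha> * (v \<bullet> (z - y)) \<le> \<alpha> * (norm v * norm (z - y))" using \<alpha> by simp
    with 1 have "1/2 * (norm (z - y))\<^sup>2 - \<alpha> * norm v * norm (z - y) \<le> K"
      unfolding K_def by (simp add: inner_diff_right algebra_simps)
    then have 2: "(norm (z - y) - \<alpha> * norm v)\<^sup>2 \<le> B"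
      unfolding B_def by (simp add: power2_eq_square algebra_simps)
    \<comment> \<open>The bound d \<le> 1 + d^2 yields an explicit radius without a square root of
      \<open>B\<close>.\<close>
    have "0 \<le> (norm (z - y) - \<alpha> * norm v - 1/2)\<^sup>2" by simp
    then have "norm (z - y) - \<alpha> * norm v \<le> 1 + (norm (z - y) - \<alpha> * norm v)\<^sup>2"
      by (simp add: power2_eq_square algebra_simps)
    with 2 show "y \<in> cball z (\<alpha> * norm v + 1 + B)" by (simp add: dist_norm)
  qed
  then have "compact {y. \<phi> y \<le> \<phi> s}"
    using closed_sub[of s] bounded_subset[OF bounded_cball] by (auto simp: compact_eq_bounded_closed)
  from closed_sublevels_attain_min[OF closed_sub this] show ?thesis
    unfolding \<phi>_def .
qed

section \<open>First-order inequalities for \<open>g\<close> and \<open>f\<close>\<close>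

text \<open>Here -v is a subgradient of \<open>g\<close> at \<open>s\<close>. Along the segment from
  \<open>s\<close> to \<open>y\<close>, the error of the upper model is of order t^2 while all other
  terms are linear in t; dividing by t and letting t tend to 0 removes it. It serves twice: with
  \<open>q = f\<close> at a solution, and with \<open>q\<close> quadratic at a proximal
  point.\<close>

lemma minimizer_subgradient:
  fixes g :: "'a::real_inner \<Rightarrow> ereal" and q :: "'a \<Rightarrow> real"
  assumes convex: "convex_fun g" and finite_s: "\<bar>g s\<bar> \<noteq> \<infinity>"
    and upper: "\<And>y. q y \<le> q s + v \<bullet> (y - s) + K * (norm (y - s))\<^sup>2"
    and minimal: "\<And>y. ereal (q s) + g s \<le> ereal (q y) + g y"
  shows "g s - ereal (v \<bullet> (y - s)) \<le> g y"
proof (cases "g y")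
  case MInf
  then show ?thesis using minimal[of y] finite_s by auto
next
  case (real b)
  obtain a where a: "g s = ereal a" using finite_s by auto
  define N where "N = K * (norm (y - s))\<^sup>2"
  have bound: "0 \<le> v \<bullet> (y - s) + t * N + b - a" if t: "0 < t" "t < 1" for t
  proof -
    define p where "p = (1 - t) *\<^sub>R s + t *\<^sub>R y"
    have p: "p - s = t *\<^sub>R (y - s)" by (simp add: p_def algebra_simps)
    have "g p \<le> ereal (1 - t) * g s + ereal t * g y"
      using convex t unfolding convex_fun_def p_def by (auto dest: spec[of _ s])
    then have gp: "g p \<le> ereal ((1 - t) * a + t * b)" by (simp add: a real)
    have "ereal (q s + a) \<le> ereal (q p) + g p" using minimal[of p] by (simp add: a)
    also have "\<dots> \<le> ereal (q p) + ereal ((1 - t) * a + t * b)"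
      using gp by (rule add_left_mono)
    finally have "q s + a \<le> q p + ((1 - t) * a + t * b)" by simp
    also have "q p \<le> q s + t * (v \<bullet> (y - s)) + t\<^sup>2 * N"
      using upper[of p] by (simp add: p N_def power_mult_distrib mult_ac)
    finally have "0 \<le> t * (v \<bullet> (y - s) + t * N + b - a)"
      by (simp add: algebra_simps power2_eq_square)
    with t show ?thesis by (simp add: zero_le_mult_iff)
  qed
  have "((\<lambda>t. v \<bullet> (y - s) + t * N + b - a) \<longlongrightarrow> v \<bullet> (y - s) + 0 * N + b - a) (at_right 0)"
    by (intro tendsto_intros)
  moreover have "eventually (\<lambda>t. 0 \<le> v \<bullet> (y - s) + t * N + b - a) (at_right 0)"
    using bound by (auto simp: eventually_at_right_field intro!: exI[of _ 1])
  ultimately have "0 \<le> v \<bullet> (y - s) + 0 * N + b - a"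
    by (rule tendsto_lowerbound) simp
  then show ?thesis by (simp add: a real)
qed simp

text \<open>The descent lemma, proved by monotonicity instead of integration: \<open>f\<close> minus
  its quadratic model has nonpositive derivative along the segment, by Cauchy-Schwarz and the
  Lipschitz bound.\<close>

lemma lipschitz_gradient_quadratic_upper:
  fixes f :: "'a::real_inner \<Rightarrow> real"
  assumes grad: "\<And>y. GDERIV f y :> gradf y"
    and lip: "\<And>y z. norm (gradf z - gradf y) \<le> L * norm (z - y)"
  shows "f z \<le> f y + gradf y \<bullet> (z - y) + L / 2 * (norm (z - y))\<^sup>2"
proof -
  define d where "d = z - y"
  define \<phi> where "\<phi> t = f (y + t *\<^sub>R d) - t * (gradf y \<bullet> d) - L / 2 * t\<^sup>2 * (norm d)\<^sup>2" for t
  have "\<phi> 1 \<le> \<phi> 0"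
  proof (rule DERIV_nonpos_imp_nonincreasing[of 0 1 \<phi>])
    fix t :: real assume t: "0 \<le> t" "t \<le> 1"
    let ?D = "d \<bullet> gradf (y + t *\<^sub>R d) - gradf y \<bullet> d - L * t * (norm d)\<^sup>2"
    have line: "((\<lambda>t. f (y + t *\<^sub>R d)) has_derivative (\<lambda>h. (h *\<^sub>R d) \<bullet> gradf (y + t *\<^sub>R d))) (at t)"
      by (rule has_derivative_compose[where g = f, OF _ grad[unfolded gderiv_def]])
         (auto intro!: derivative_eq_intros)
    then have "((\<lambda>t. f (y + t *\<^sub>R d)) has_field_derivative d \<bullet> gradf (y + t *\<^sub>R d)) (at t)"
      by (simp add: has_field_derivative_def mult.commute[of _ "d \<bullet> _"])
    then have "(\<phi> has_field_derivative ?D) (at t)"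
      unfolding \<phi>_def by (auto intro!: derivative_eq_intros)
    moreover have "?D \<le> 0"
    proof -
      have "d \<bullet> (gradf (y + t *\<^sub>R d) - gradf y) \<le> norm d * norm (gradf (y + t *\<^sub>R d) - gradf y)"
        by (rule norm_cauchy_schwarz)
      also have "\<dots> \<le> norm d * (L * (t * norm d))"
        using lip[of "y + t *\<^sub>R d" y] t by (intro mult_left_mono) auto
      finally show ?thesis
        by (simp add: inner_diff_right inner_commute power2_eq_square algebra_simps)
    qed
    ultimately show "\<exists>y. (\<phi> has_field_derivative y) (at t) \<and> y \<le> 0" by blast
  qed simp
  then show ?thesis by (simp add: \<phi>_def d_def algebra_simps)
qed

text \<open>The upper bound for -f. As \<open>f\<close> is not assumed convex, this takes the place
  of the gradient inequality.\<close>

lemma lipschitz_gradient_quadratic_lower: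
  fixes f :: "'a::real_inner \<Rightarrow> real"
  assumes "\<And>y. GDERIV f y :> gradf y"
    and "\<And>y z. norm (gradf z - gradf y) \<le> L * norm (z - y)"
  shows "f y + gradf y \<bullet> (z - y) - L / 2 * (norm (z - y))\<^sup>2 \<le> f z"
  using lipschitz_gradient_quadratic_upper[of "\<lambda>y. - f y" "\<lambda>y. - gradf y" L z y] assms
  by (simp add: GDERIV_minus norm_minus_commute)

section \<open>Deterministic analysis of the proximal map\<close>

locale prox_gradient =
  fixes f :: "'a::euclidean_space \<Rightarrow> real" and gradf :: "'a \<Rightarrow> 'a" and g :: "'a \<Rightarrow> ereal"
    and L \<tau> :: real
  assumes gradient: "\<And>y. GDERIV f y :> gradf y"
    and g_proper: "proper_fun g"
    and g_convex: "convex_fun g"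
    and g_lsc: "lsc_fun g"
    and sol_nonempty: "argmin_set (composite f g) \<noteq> {}"
    and L_pos: "L > 0"
    and tau_ge_1: "\<tau> \<ge> 1"
    and gradient_lipschitz: "\<And>y z. norm (gradf z - gradf y) \<le> L * norm (z - y)"
    and error_bound:
      "\<And>y. infdist y (argmin_set (composite f g))
             \<le> \<tau> * norm (y - prox (1/L) g (y - (1/L) *\<^sub>R gradf y))"
begin

text \<open>At infinite values this is the default 0, so it represents \<open>g\<close> only on
  \<open>eff_dom g\<close>; hence the domain side conditions below.\<close>

abbreviation G :: "'a \<Rightarrow> real" where "G y \<equiv> real_of_ereal (g y)"

lemma eff_dom_cases:
  assumes "y \<in> eff_dom g"
  obtains b where "g y = ereal b"
  using assms g_proper by (cases "g y") (auto simp: eff_dom_def proper_fun_def)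

lemmas upper = lipschitz_gradient_quadratic_upper[OF gradient gradient_lipschitz]
lemmas lower = lipschitz_gradient_quadratic_lower[OF gradient gradient_lipschitz]

lemma argminD:
  assumes "s \<in> argmin_set (composite f g)"
  shows argmin_le: "composite f g s \<le> composite f g y"
    and argmin_dom: "s \<in> eff_dom g"
proof -
  show le: "composite f g s \<le> composite f g y" for y
    using assms by (auto simp: argmin_set_def is_arg_min_def not_less)
  obtain y where "g y \<noteq> \<infinity>" using g_proper by (auto simp: proper_fun_def)
  with le[of y] show "s \<in> eff_dom g" by (auto simp: composite_def eff_dom_def)
qed

lemma opt_gap_eq:
  assumes "s \<in> argmin_set (composite f g)" "y \<in> eff_dom g"
  shows "opt_gap (composite f g) y = ereal (f y + G y - (f s + G s))"
proof -
  have "(INF y. composite f g y) = composite f g s"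
    by (rule antisym) (auto intro: INF_lower INF_greatest argmin_le[OF assms(1)])
  then show ?thesis
    using assms(2) argmin_dom[OF assms(1)]
    by (auto simp: opt_gap_def composite_def elim!: eff_dom_cases)
qed

text \<open>Fermat's rule at a minimizer of the composite gives an affine minorant of \<open>g\<close>, hence
  coercivity of the proximal objective without a general separation theorem.\<close>

lemma prox_minimal:
  "ereal (1/L) * g (prox (1/L) g z) + ereal (1/2 * (norm (z - prox (1/L) g z))\<^sup>2)
   \<le> ereal (1/L) * g w + ereal (1/2 * (norm (z - w))\<^sup>2)"
proof -
  obtain s where s: "s \<in> argmin_set (composite f g)" using sol_nonempty by blast
  obtain a where gs: "g s = ereal a" by (rule eff_dom_cases[OF argmin_dom[OF s]])
  have "g s - ereal (gradf s \<bullet> (y - s)) \<le> g y" for y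
    using argmin_le[OF s] gs
    by (intro minimizer_subgradient[OF g_convex, where q = f and K = "L/2"] upper)
       (auto simp: composite_def)
  then have "ereal ((a + gradf s \<bullet> s) + (- gradf s) \<bullet> y) \<le> g y" for y
    by (simp add: gs inner_diff_right algebra_simps)
  from prox_objective_attains_min[OF g_lsc _ _ this, where s = s and \<alpha> = "1/L"]
  obtain y where "\<And>w. ereal (1/L) * g y + ereal (1/2 * (norm (z - y))\<^sup>2)
                  \<le> ereal (1/L) * g w + ereal (1/2 * (norm (z - w))\<^sup>2)"
    using gs L_pos by auto
  then have "\<exists>y. is_arg_min (\<lambda>y. ereal (1/L) * g y + ereal (1/2 * (norm (z - y))\<^sup>2)) (\<lambda>_. True) y"
    by (auto simp: is_arg_min_def not_less)
  then have "is_arg_min (\<lambda>y. ereal (1/L) * g y + ereal (1/2 * (norm (z - y))\<^sup>2)) (\<lambda>_. True)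
      (prox (1/L) g z)"
    unfolding prox_def arg_min_def by (rule someI_ex)
  then show ?thesis by (simp only: is_arg_min_def not_less simp_thms not_ex)
qed

lemma prox_dom: "prox (1/L) g z \<in> eff_dom g"
proof -
  obtain w where w: "g w \<noteq> \<infinity>" using g_proper by (auto simp: proper_fun_def)
  have "g w \<noteq> - \<infinity>" using g_proper by (auto simp: proper_fun_def)
  with w prox_minimal[of z w] L_pos show ?thesis
    by (cases "g w"; cases "g (prox (1/L) g z)") (auto simp: eff_dom_def)
qed

text \<open>Optimality at \<open>p\<close> says that L (z - p) is a subgradient of \<open>g\<close>
  there. The objective is rescaled by \<open>L\<close> to give \<open>g\<close> coefficient one, and
  the quadratic expands exactly about \<open>p\<close> with \<open>K = L/2\<close>.\<close>

lemma prox_subgradient: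
  fixes y z :: 'a
  assumes y: "y \<in> eff_dom g"
  defines "p \<equiv> prox (1/L) g z"
  shows "G p + L * ((z - p) \<bullet> (y - p)) \<le> G y"
proof -
  obtain a where gp: "g p = ereal a" using prox_dom eff_dom_cases unfolding p_def by blast
  have not_minf: "g w \<noteq> - \<infinity>" for w using g_proper by (auto simp: proper_fun_def)
  have "g p - ereal ((- L *\<^sub>R (z - p)) \<bullet> (y - p)) \<le> g y"
  proof (rule minimizer_subgradient[OF g_convex, where q = "\<lambda>w. L/2 * (norm (z - w))\<^sup>2" and K = "L/2"])
    show "\<bar>g p\<bar> \<noteq> \<infinity>" using gp by simp
    show "L/2 * (norm (z - w))\<^sup>2
        \<le> L/2 * (norm (z - p))\<^sup>2 + (- L *\<^sub>R (z - p)) \<bullet> (w - p) + L/2 * (norm (w - p))\<^sup>2" for w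
      by (simp add: power2_norm_eq_inner inner_diff_left inner_diff_right inner_commute algebra_simps)
    show "ereal (L/2 * (norm (z - p))\<^sup>2) + g p \<le> ereal (L/2 * (norm (z - w))\<^sup>2) + g w" for w
    proof (cases "g w")
      case (real b)
      have "1/L * a + 1/2 * (norm (z - p))\<^sup>2 \<le> 1/L * b + 1/2 * (norm (z - w))\<^sup>2"
        using prox_minimal[of z w, folded p_def] gp real by simp
      then have "L * (1/L * a + 1/2 * (norm (z - p))\<^sup>2) \<le> L * (1/L * b + 1/2 * (norm (z - w))\<^sup>2)"
        using L_pos by (intro mult_left_mono) auto
      then show ?thesis using L_pos gp real by (simp add: ring_distribs)
    qed (use not_minf[of w] in auto)
  qed
  then show ?thesis using y gp by (auto elim!: eff_dom_cases)
qed

text \<open>Adding the subgradient inequalities at the two proximal points cancels the values of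
  \<open>g\<close> and leaves monotonicity; Cauchy-Schwarz finishes.\<close>

lemma prox_nonexpansive: "norm (prox (1/L) g z - prox (1/L) g w) \<le> norm (z - w)"
proof -
  let ?p = "prox (1/L) g z" and ?q = "prox (1/L) g w"
  have "L * ((z - ?p) \<bullet> (?q - ?p) + (w - ?q) \<bullet> (?p - ?q)) \<le> 0"
    using prox_subgradient[OF prox_dom[of w], of z] prox_subgradient[OF prox_dom[of z], of w]
    by (simp add: algebra_simps)
  then have "(z - ?p) \<bullet> (?q - ?p) + (w - ?q) \<bullet> (?p - ?q) \<le> 0"
    using L_pos by (simp add: mult_le_0_iff)
  then have "(norm (?p - ?q))\<^sup>2 \<le> (z - w) \<bullet> (?p - ?q)"
    by (simp add: power2_norm_eq_inner inner_diff_left inner_diff_right inner_commute)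
  also have "\<dots> \<le> norm (z - w) * norm (?p - ?q)" by (rule norm_cauchy_schwarz)
  finally show ?thesis
    by (cases "norm (?p - ?q) = 0") (auto simp: power2_eq_square)
qed

section \<open>One inexact step and its unrolling\<close>

lemma inexact_step_gap:
  fixes x s err :: 'a
  assumes x: "x \<in> eff_dom g" and s: "s \<in> argmin_set (composite f g)"
  defines "y \<equiv> prox (1/L) g (x - (1/L) *\<^sub>R (gradf x + err))"
  shows "f y + G y - (f s + G s) \<le> rho \<tau> * (f x + G x - (f s + G s) + (norm err)\<^sup>2 / L)"
proof -
  define S where "S = argmin_set (composite f g)"
  define r where "r = norm (x - y)"
  define u where "u = norm err / L"
  define \<pi> where "\<pi> w = f w + G w - (f s + G s)" for w
  have err: "norm err = L * u" using L_pos by (simp add: u_def)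
  have subgrad: "G y + (L *\<^sub>R (x - y) - gradf x - err) \<bullet> (w - y) \<le> G w" if "w \<in> eff_dom g" for w
  proof -
    have "L *\<^sub>R (x - (1/L) *\<^sub>R (gradf x + err) - y) = L *\<^sub>R (x - y) - gradf x - err"
      using L_pos by (simp add: algebra_simps)
    then have "L * ((x - (1/L) *\<^sub>R (gradf x + err) - y) \<bullet> (w - y))
        = (L *\<^sub>R (x - y) - gradf x - err) \<bullet> (w - y)"
      by (metis inner_scaleR_left)
    with prox_subgradient[OF that, of "x - (1/L) *\<^sub>R (gradf x + err)", folded y_def]
    show ?thesis by simp
  qed
  \<comment> \<open>Taking \<open>w = x\<close> in \<open>subgrad\<close> gains L r^2, of which the
    descent lemma uses only half.\<close>
  have decrease: "L * (r\<^sup>2 / 2 - u * r) \<le> \<pi> x - \<pi> y"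
  proof -
    have "err \<bullet> (x - y) \<le> L * u * r"
      using norm_cauchy_schwarz[of err "x - y"] by (simp add: err r_def)
    moreover have "f y \<le> f x + gradf x \<bullet> (y - x) + L/2 * r\<^sup>2"
      using upper[of y x] by (simp add: r_def norm_minus_commute)
    moreover have "G y + L * r\<^sup>2 - gradf x \<bullet> (x - y) - err \<bullet> (x - y) \<le> G x"
      using subgrad[OF x] by (simp add: r_def power2_norm_eq_inner inner_diff_left)
    ultimately show ?thesis by (simp add: \<pi>_def inner_diff_right algebra_simps)
  qed
  \<comment> \<open>The upper model at \<open>y\<close> and the lower model at \<open>w\<close> are
    both centred at \<open>x\<close>, so the gradient terms cancel against those in
    \<open>subgrad\<close>.\<close>
  have to_solution: "\<pi> y \<le> L * (dist x w)\<^sup>2 + L * u\<^sup>2 / 2" if w: "w \<in> S" for w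
  proof -
    have dom: "w \<in> eff_dom g" using argmin_dom w by (simp add: S_def)
    have same: "f w + G w = f s + G s"
    proof -
      have "composite f g w = composite f g s"
        using argmin_le w s unfolding S_def by (intro antisym)
      then show ?thesis
        using dom argmin_dom[OF s] by (auto simp: composite_def elim!: eff_dom_cases)
    qed
    have "f y \<le> f x + gradf x \<bullet> (y - x) + L/2 * (norm (y - x))\<^sup>2" by (rule upper)
    moreover have "f x + gradf x \<bullet> (w - x) - L/2 * (norm (w - x))\<^sup>2 \<le> f w" by (rule lower)
    moreover have "G y + L * ((x - y) \<bullet> (w - y)) - gradf x \<bullet> (w - y) - err \<bullet> (w - y) \<le> G w"
      using subgrad[OF dom] by (simp add: inner_diff_left)
    \<comment> \<open>Young's inequality, weighted so that its L/2 |w - y|^2 is exactly cancelled by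
      the term that the polarization identity below supplies.\<close>
    moreover have "err \<bullet> (w - y) \<le> L * u\<^sup>2 / 2 + L/2 * (norm (w - y))\<^sup>2"
    proof -
      have "err \<bullet> (w - y) \<le> L * u * norm (w - y)"
        using norm_cauchy_schwarz[of err "w - y"] by (simp add: err)
      moreover have "0 \<le> L / 2 * (u - norm (w - y))\<^sup>2" using L_pos by simp
      ultimately show ?thesis by (simp add: power2_eq_square algebra_simps)
    qed
    moreover have "(x - y) \<bullet> (w - y) = ((norm (y - x))\<^sup>2 + (norm (w - y))\<^sup>2 - (norm (w - x))\<^sup>2) / 2"
      by (simp add: power2_norm_eq_inner inner_diff_left inner_diff_right inner_commute)
    then have "L * ((x - y) \<bullet> (w - y))
        = L/2 * (norm (y - x))\<^sup>2 + L/2 * (norm (w - y))\<^sup>2 - L/2 * (norm (w - x))\<^sup>2"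
      by (simp only:) (simp add: field_simps)
    moreover have "dist x w = norm (w - x)" by (simp add: dist_norm norm_minus_commute)
    ultimately show ?thesis
      unfolding \<pi>_def using same by (simp add: inner_diff_right)
  qed
  \<comment> \<open>The error bound concerns the exact step \<open>?p\<close>; nonexpansiveness puts
    it within \<open>u\<close> of \<open>y\<close>.\<close>
  have dist_bound: "infdist x S \<le> \<tau> * (r + u)"
  proof -
    let ?p = "prox (1/L) g (x - (1/L) *\<^sub>R gradf x)"
    have "norm (y - ?p) \<le> norm ((x - (1/L) *\<^sub>R (gradf x + err)) - (x - (1/L) *\<^sub>R gradf x))"
      unfolding y_def by (rule prox_nonexpansive)
    also have "\<dots> = u" using L_pos by (simp add: algebra_simps u_def)
    finally have "norm (x - ?p) \<le> r + u"
      using norm_triangle_ineq[of "x - y" "y - ?p"] by (simp add: r_def)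
    then have "\<tau> * norm (x - ?p) \<le> \<tau> * (r + u)" using tau_ge_1 by (intro mult_left_mono) auto
    then show ?thesis using error_bound[of x] by (simp add: S_def)
  qed
  have gap: "\<pi> y \<le> L * (\<tau> * (r + u))\<^sup>2 + L * u\<^sup>2 / 2"
  proof -
    \<comment> \<open>Square roots turn the bounds over all \<open>w\<close> into one against
      \<open>infdist\<close>, without choosing a nearest minimizer. \<open>b\<close> may be
      negative, where \<open>sqrt\<close> is negative too.\<close>
    define b where "b = (\<pi> y - L * u\<^sup>2 / 2) / L"
    have "sqrt b \<le> dist x w" if "w \<in> S" for w
    proof (rule real_le_lsqrt)
      show "b \<le> (dist x w)\<^sup>2"
        using to_solution[OF that] L_pos by (simp add: b_def field_simps)
    qed simp
    then have "sqrt b \<le> infdist x S"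
      using s by (auto simp: infdist_def S_def intro!: cINF_greatest)
    with dist_bound have "sqrt b \<le> \<tau> * (r + u)" by linarith
    then have "b \<le> (\<tau> * (r + u))\<^sup>2" by (rule sqrt_le_D)
    then show ?thesis using L_pos by (simp add: b_def field_simps)
  qed
  \<comment> \<open>The source of the constant 40: the difference of the sides is 19 r^2 - 42 u r +
    77/2 u^2, and completing the square leaves a positive multiple of u^2.\<close>
  have "(r + u)\<^sup>2 + u\<^sup>2 / 2 \<le> 40 * (r\<^sup>2 / 2 - u * r + u\<^sup>2)"
  proof -
    have "0 \<le> 19 * (r - 21/19 * u)\<^sup>2 + (38 + 1/2 - 441/19) * u\<^sup>2" by simp
    then show ?thesis by (simp add: power2_eq_square algebra_simps)
  qed
  then have "L * \<tau>\<^sup>2 * ((r + u)\<^sup>2 + u\<^sup>2 / 2) \<le> L * \<tau>\<^sup>2 * (40 * (r\<^sup>2 / 2 - u * r + u\<^sup>2))"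
    using L_pos by (intro mult_left_mono) auto
  moreover have "L * u\<^sup>2 / 2 \<le> L * \<tau>\<^sup>2 * (u\<^sup>2 / 2)"
  proof -
    have "1 \<le> \<tau>\<^sup>2" using tau_ge_1 by (simp add: one_le_power)
    then have "L * u\<^sup>2 / 2 * 1 \<le> L * u\<^sup>2 / 2 * \<tau>\<^sup>2" using L_pos by (intro mult_left_mono) auto
    then show ?thesis by (simp add: algebra_simps)
  qed
  moreover have "40 * \<tau>\<^sup>2 * (L * (r\<^sup>2 / 2 - u * r)) \<le> 40 * \<tau>\<^sup>2 * (\<pi> x - \<pi> y)"
    using decrease by (intro mult_left_mono) auto
  ultimately have "\<pi> y \<le> 40 * \<tau>\<^sup>2 * (\<pi> x - \<pi> y + L * u\<^sup>2)"
    using gap[unfolded power_mult_distrib] by (simp add: algebra_simps)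
  \<comment> \<open>Collecting \<open>\<pi> y\<close> on the left produces the factor
    \<open>rho \<tau>\<close>, of the form C/(1 + C) with C = 40 \<tau>^2.\<close>
  then have "(1 + 40 * \<tau>\<^sup>2) * \<pi> y \<le> 40 * \<tau>\<^sup>2 * (\<pi> x + L * u\<^sup>2)"
    by (simp add: algebra_simps)
  moreover have "0 < 1 + 40 * \<tau>\<^sup>2" by (simp add: add_pos_nonneg)
  ultimately have "\<pi> y \<le> rho \<tau> * (\<pi> x + L * u\<^sup>2)"
    by (simp add: rho_def field_simps)
  moreover have "L * u\<^sup>2 = (norm err)\<^sup>2 / L"
    using L_pos by (simp add: u_def power2_eq_square)
  ultimately show ?thesis by (simp add: \<pi>_def)
qed

text \<open>Domain membership is part of the induction because the one-step estimate requires it.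
  The error weight becomes 1/\<open>vartheta L \<tau>\<close> since \<open>vartheta L \<tau>\<close>
  equals \<open>L\<close> divided by \<open>rho \<tau>\<close>.\<close>

lemma inexact_iterates_gap:
  assumes x0: "x 0 \<in> eff_dom g" and s: "s \<in> argmin_set (composite f g)"
    and step: "\<And>k. x (Suc k) = prox (1/L) g (x k - (1/L) *\<^sub>R (gradf (x k) + err k))"
  shows "x k \<in> eff_dom g
    \<and> f (x k) + G (x k) - (f s + G s)
      \<le> rho \<tau> ^ k * (f (x 0) + G (x 0) - (f s + G s))
        + (\<Sum>i<k. rho \<tau> ^ (k - 1 - i) * (norm (err i))\<^sup>2) / vartheta L \<tau>"
proof (induction k)
  case 0
  then show ?case using x0 by simp
next
  case (Suc k)
  let ?\<pi> = "\<lambda>k. f (x k) + G (x k) - (f s + G s)"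
  have rho: "0 \<le> rho \<tau>" by (simp add: rho_def)
  have inv: "rho \<tau> * (a / L) = a / vartheta L \<tau>" for a
    by (simp add: rho_def vartheta_def mult_ac)
  have "?\<pi> (Suc k) \<le> rho \<tau> * (?\<pi> k + (norm (err k))\<^sup>2 / L)"
    unfolding step using inexact_step_gap[OF _ s] Suc by blast
  also have "\<dots> \<le> rho \<tau> * (rho \<tau> ^ k * ?\<pi> 0
      + (\<Sum>i<k. rho \<tau> ^ (k - 1 - i) * (norm (err i))\<^sup>2) / vartheta L \<tau> + (norm (err k))\<^sup>2 / L)"
    using Suc rho by (intro mult_left_mono add_right_mono) auto
  also have "\<dots> = rho \<tau> ^ Suc k * ?\<pi> 0
      + (\<Sum>i<k. rho \<tau> * rho \<tau> ^ (k - 1 - i) * (norm (err i))\<^sup>2) / vartheta L \<tau>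
      + (norm (err k))\<^sup>2 / vartheta L \<tau>"
    by (simp only: ring_distribs inv) (simp add: sum_distrib_left mult.assoc)
  \<comment> \<open>Since i < k, the truncated exponent k - 1 - i really increases to k - i, which
    is Suc k - 1 - i; the new error enters with exponent 0.\<close>
  also have "(\<Sum>i<k. rho \<tau> * rho \<tau> ^ (k - 1 - i) * (norm (err i))\<^sup>2)
      = (\<Sum>i<k. rho \<tau> ^ (k - i) * (norm (err i))\<^sup>2)"
    by (intro sum.cong refl) (simp add: power_Suc[symmetric] Suc_diff_Suc del: power_Suc)
  finally show ?case
    using prox_dom by (simp add: step add_divide_distrib del: power_Suc)
qed

end

section \<open>Geometric weights and Jensen's inequality\<close>

lemma Rsum_pos: "k \<ge> 1 \<Longrightarrow> \<tau> \<ge> 1 \<Longrightarrow> Rsum \<tau> k > 0"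
  unfolding Rsum_def by (intro sum_pos) (auto simp: rho_def zero_less_divide_iff add_pos_nonneg lessThan_empty_iff)

lemma Rsum_reversed: "(\<Sum>i<k. rho \<tau> ^ (k - 1 - i)) = Rsum \<tau> k"
  using sum.nat_diff_reindex[of "\<lambda>i. rho \<tau> ^ i" k] by (simp add: Rsum_def)

text \<open>Jensen's inequality: after division by \<open>Rsum \<tau> k\<close> the weights sum to
  one, by \<open>Rsum_reversed\<close>.\<close>

lemma exp_weighted_sum_le:
  assumes "k \<ge> 1" "\<tau> \<ge> 1"
  shows "exp ((\<Sum>i<k. rho \<tau> ^ (k - 1 - i) * a i) / Rsum \<tau> k)
    \<le> (\<Sum>i<k. rho \<tau> ^ (k - 1 - i) * exp (a i)) / Rsum \<tau> k"
proof -
  have R: "Rsum \<tau> k > 0" using assms by (rule Rsum_pos)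
  have "exp (\<Sum>i<k. (rho \<tau> ^ (k - 1 - i) / Rsum \<tau> k) *\<^sub>R a i)
      \<le> (\<Sum>i<k. rho \<tau> ^ (k - 1 - i) / Rsum \<tau> k * exp (a i))"
    using R assms
    by (intro convex_on_sum[OF _ _ exp_convex])
       (auto simp: sum_divide_distrib[symmetric] Rsum_reversed[simplified] lessThan_empty_iff
          intro!: divide_nonneg_nonneg zero_le_power, simp add: rho_def)
  then show ?thesis by (simp add: sum_divide_distrib)
qed

section \<open>From the pathwise estimate to the tail bound\<close>

theorem theorem3p1:
  fixes f :: "real ^ 'n \<Rightarrow> real"
    and gradf :: "real ^ 'n \<Rightarrow> real ^ 'n"
    and g :: "real ^ 'n \<Rightarrow> ereal"
    and L \<tau> :: real
    and M :: "'w measure"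
    and e :: "nat \<Rightarrow> 'w \<Rightarrow> real ^ 'n"
    and x0 :: "real ^ 'n"
    and x :: "nat \<Rightarrow> 'w \<Rightarrow> real ^ 'n"
  assumes gradient: "\<And>y. GDERIV f y :> gradf y"
    and g_proper: "proper_fun g"
    and g_convex: "convex_fun g"
    and g_lsc: "lsc_fun g"
    and sol_nonempty: "argmin_set (composite f g) \<noteq> {}"
    and L_pos: "L > 0"
    and tau_ge_1: "\<tau> \<ge> 1"
    and gradient_lipschitz: "\<And>y z. norm (gradf z - gradf y) \<le> L * norm (z - y)"
    and error_bound:
      "\<And>y. infdist y (argmin_set (composite f g))
             \<le> \<tau> * norm (y - prox (1/L) g (y - (1/L) *\<^sub>R gradf y))"
    and prob: "prob_space M"
    and e_random: "\<And>k. e k \<in> borel_measurable M"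
    and x0_dom: "x0 \<in> eff_dom g"
    and x_start: "\<And>\<omega>. \<omega> \<in> space M \<Longrightarrow> x 0 \<omega> = x0"
    and x_step: "\<And>k \<omega>. \<omega> \<in> space M \<Longrightarrow>
      x (Suc k) \<omega> = prox (1/L) g (x k \<omega> - (1/L) *\<^sub>R (gradf (x k \<omega>) + e k \<omega>))"
  shows
    "(\<forall>k\<ge>1. \<forall>\<epsilon>>0.
        ennreal \<P>(\<omega> in M. opt_gap (composite f g) (x k \<omega>)
                     - ereal (rho \<tau> ^ k) * opt_gap (composite f g) (x 0 \<omega>) \<ge> ereal \<epsilon>)
        \<le> (INF \<theta>\<in>{0<..}.
             ennreal (exp (- \<theta> * vartheta L \<tau> * \<epsilon> / Rsum \<tau> k) / Rsum \<tau> k)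
             * (\<Sum>i<k. ennreal (rho \<tau> ^ (k - 1 - i)) * sqnorm_mgf M (e i) \<theta>)))
     \<and> (\<forall>\<gamma>. (\<forall>k. sqnorm_mgf M (e k) = \<gamma>) \<longrightarrow>
          (\<forall>k\<ge>1. \<forall>\<epsilon>>0.
             ennreal \<P>(\<omega> in M. opt_gap (composite f g) (x k \<omega>)
                          - ereal (rho \<tau> ^ k) * opt_gap (composite f g) (x 0 \<omega>) \<ge> ereal \<epsilon>)
             \<le> (INF \<theta>\<in>{0<..}.
                  ennreal (exp (- \<theta> * vartheta L \<tau> * \<epsilon> / Rsum \<tau> k)) * \<gamma> \<theta>)))"
proof -
  interpret prox_gradient f gradf g L \<tau>
    by unfold_locales fact+
  obtain s where s: "s \<in> argmin_set (composite f g)" using sol_nonempty by blast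
  have theta_pos: "vartheta L \<tau> > 0"
    using L_pos tau_ge_1 unfolding vartheta_def by (intro mult_pos_pos divide_pos_pos add_pos_nonneg) auto
  have first: "ennreal \<P>(\<omega> in M. opt_gap (composite f g) (x k \<omega>)
                     - ereal (rho \<tau> ^ k) * opt_gap (composite f g) (x 0 \<omega>) \<ge> ereal \<epsilon>)
        \<le> ennreal (exp (- \<theta> * vartheta L \<tau> * \<epsilon> / Rsum \<tau> k) / Rsum \<tau> k)
             * (\<Sum>i<k. ennreal (rho \<tau> ^ (k - 1 - i)) * sqnorm_mgf M (e i) \<theta>)"
    (is "ennreal (measure M ?A) \<le> ennreal ?c * _")
    if k: "k \<ge> 1" and \<theta>: "\<theta> > 0" for k \<epsilon> \<theta>
  proof -
    have R: "Rsum \<tau> k > 0" using k tau_ge_1 by (rule Rsum_pos)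
    have rho: "0 \<le> rho \<tau>" by (simp add: rho_def)
    \<comment> \<open>\<open>F\<close> already contains the factor of the claimed bound, so Markov's
      inequality amounts to integrating 1 \<le> \<open>F\<close> over the event.\<close>
    define F where "F \<omega> = ?c * (\<Sum>i<k. rho \<tau> ^ (k - 1 - i) * exp (\<theta> * (norm (e i \<omega>))\<^sup>2))" for \<omega>
    have F_ge_1: "1 \<le> F \<omega>" if "\<omega> \<in> ?A" for \<omega>
    proof -
      from that have \<omega>: "\<omega> \<in> space M" by simp
      define W where "W = (\<Sum>i<k. rho \<tau> ^ (k - 1 - i) * (norm (e i \<omega>))\<^sup>2)"
      have dom0: "x 0 \<omega> \<in> eff_dom g" using x0_dom x_start[OF \<omega>] by simp
      \<comment> \<open>The deterministic estimate is applied to the single sample path of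
        \<open>\<omega>\<close>.\<close>
      note it = inexact_iterates_gap[of "\<lambda>k. x k \<omega>" s "\<lambda>k. e k \<omega>" k, OF dom0 s x_step[OF \<omega>]]
      have "\<epsilon> \<le> W / vartheta L \<tau>"
        using that it opt_gap_eq[OF s dom0] opt_gap_eq[OF s, of "x k \<omega>"] by (simp add: W_def)
      then have "\<theta> * (vartheta L \<tau> * \<epsilon>) \<le> \<theta> * W"
        using theta_pos \<theta> by (intro mult_left_mono) (auto simp: field_simps)
      then have "- \<theta> * vartheta L \<tau> * \<epsilon> / Rsum \<tau> k + \<theta> * W / Rsum \<tau> k \<ge> 0"
        using R by (simp add: field_simps)
      then have "1 \<le> exp (- \<theta> * vartheta L \<tau> * \<epsilon> / Rsum \<tau> k) * exp (\<theta> * W / Rsum \<tau> k)"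
        by (subst exp_add[symmetric]) simp
      also have "\<theta> * W = (\<Sum>i<k. rho \<tau> ^ (k - 1 - i) * (\<theta> * (norm (e i \<omega>))\<^sup>2))"
        by (simp add: W_def sum_distrib_left mult_ac)
      also have "exp (\<dots> / Rsum \<tau> k)
          \<le> (\<Sum>i<k. rho \<tau> ^ (k - 1 - i) * exp (\<theta> * (norm (e i \<omega>))\<^sup>2)) / Rsum \<tau> k"
        by (rule exp_weighted_sum_le[OF k tau_ge_1])
      finally show ?thesis by (simp add: F_def)
    qed
    \<comment> \<open>In \<open>ennreal\<close> the integral is additive even when some
      moment-generating function is infinite.\<close>
    have F_sum: "ennreal (F \<omega>) = ennreal ?c
        * (\<Sum>i<k. ennreal (rho \<tau> ^ (k - 1 - i)) * ennreal (exp (\<theta> * (norm (e i \<omega>))\<^sup>2)))" for \<omega>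
    proof -
      have "ennreal (F \<omega>) = ennreal ?c
          * ennreal (\<Sum>i<k. rho \<tau> ^ (k - 1 - i) * exp (\<theta> * (norm (e i \<omega>))\<^sup>2))"
        unfolding F_def using R rho by (intro ennreal_mult sum_nonneg) auto
      also have "ennreal (\<Sum>i<k. rho \<tau> ^ (k - 1 - i) * exp (\<theta> * (norm (e i \<omega>))\<^sup>2))
          = (\<Sum>i<k. ennreal (rho \<tau> ^ (k - 1 - i) * exp (\<theta> * (norm (e i \<omega>))\<^sup>2)))"
        using rho by (intro sum_ennreal[symmetric]) auto
      finally show ?thesis using rho by (simp add: ennreal_mult)
    qed
    have "ennreal (measure M ?A) \<le> (\<integral>\<^sup>+\<omega>. ennreal (F \<omega>) \<partial>M)"
    proof (cases "?A \<in> sets M")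
      case True
      have "ennreal (measure M ?A) = emeasure M ?A"
        using finite_measure.emeasure_eq_measure[OF prob_space.finite_measure[OF prob]] by simp
      also have "\<dots> = (\<integral>\<^sup>+\<omega>. indicator ?A \<omega> \<partial>M)" using True by simp
      also have "\<dots> \<le> (\<integral>\<^sup>+\<omega>. ennreal (F \<omega>) \<partial>M)"
        using F_ge_1 by (intro nn_integral_mono) (auto split: split_indicator)
      finally show ?thesis .
    next
      case False \<comment> \<open>the iterates need not be measurable; a non-measurable event has junk measure 0\<close>
      then show ?thesis by (simp add: measure_notin_sets)
    qed
    also have "\<dots> = ennreal ?c * (\<Sum>i<k. ennreal (rho \<tau> ^ (k - 1 - i)) * sqnorm_mgf M (e i) \<theta>)"
    proof -
      note [measurable] = e_random
      have mgf: "(\<integral>\<^sup>+\<omega>. ennreal (rho \<tau> ^ (k - 1 - i)) * ennreal (exp (\<theta> * (norm (e i \<omega>))\<^sup>2)) \<partial>M)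
          = ennreal (rho \<tau> ^ (k - 1 - i)) * sqnorm_mgf M (e i) \<theta>" for i
        unfolding sqnorm_mgf_def by (intro nn_integral_cmult) measurable
      have "(\<integral>\<^sup>+\<omega>. ennreal (F \<omega>) \<partial>M) = ennreal ?c * (\<integral>\<^sup>+\<omega>. (\<Sum>i<k.
          ennreal (rho \<tau> ^ (k - 1 - i)) * ennreal (exp (\<theta> * (norm (e i \<omega>))\<^sup>2))) \<partial>M)"
        unfolding F_sum by (intro nn_integral_cmult) measurable
      also have "(\<integral>\<^sup>+\<omega>. (\<Sum>i<k.
          ennreal (rho \<tau> ^ (k - 1 - i)) * ennreal (exp (\<theta> * (norm (e i \<omega>))\<^sup>2))) \<partial>M)
          = (\<Sum>i<k. ennreal (rho \<tau> ^ (k - 1 - i)) * sqnorm_mgf M (e i) \<theta>)"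
        unfolding mgf[symmetric] by (intro nn_integral_sum) measurable
      finally show ?thesis .
    qed
    finally show ?thesis .
  qed
  have second: "ennreal \<P>(\<omega> in M. opt_gap (composite f g) (x k \<omega>)
                     - ereal (rho \<tau> ^ k) * opt_gap (composite f g) (x 0 \<omega>) \<ge> ereal \<epsilon>)
        \<le> ennreal (exp (- \<theta> * vartheta L \<tau> * \<epsilon> / Rsum \<tau> k)) * \<gamma> \<theta>"
    if k: "k \<ge> 1" and \<theta>: "\<theta> > 0" and \<gamma>: "\<forall>k. sqnorm_mgf M (e k) = \<gamma>" for k \<epsilon> \<theta> \<gamma>
  proof -
    have R: "Rsum \<tau> k > 0" using k tau_ge_1 by (rule Rsum_pos)
    have rho: "0 \<le> rho \<tau>" by (simp add: rho_def)
    \<comment> \<open>With a common \<gamma> the weights sum to \<open>Rsum \<tau> k\<close>, which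
      cancels the prefactor 1/\<open>Rsum \<tau> k\<close> in \<open>first\<close>.\<close>
    have "(\<Sum>i<k. ennreal (rho \<tau> ^ (k - 1 - i)) * sqnorm_mgf M (e i) \<theta>) = ennreal (Rsum \<tau> k) * \<gamma> \<theta>"
      using \<gamma> rho by (simp only: sum_distrib_right[symmetric] Rsum_reversed sum_ennreal zero_le_power)
    with first[OF k \<theta>, of \<epsilon>] R show ?thesis
      by (simp add: mult.assoc[symmetric] ennreal_mult[symmetric])
  qed
  show ?thesis
    using first second by (auto intro!: INF_greatest)
qed

end
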